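(* Let $\mathbb{K}$ be an algebraically closed field of characteristic zero and let $A$ be a subalgebra of $\mathbb{K}[x]$ of codimension one. Then either there exists $\gamma\in\mathbb{K}$ such that for all $f\in\mathbb{K}[x]$: $f\in A\Leftrightarrow f'(\gamma)=0$, or there exist $\alpha\neq\beta$ in $\mathbb{K}$ such that for all $f\in\mathbb{K}[x]$: $f\in A\Leftrightarrow f(\alpha)=f(\beta)$.
   Context: Subalgebras of $\mathbb{K}[x]$ contain all constants. The codimension of a subalgebra $A$ is $\dim_{\mathbb{K}}\mathbb{K}[x]/A$. *)

theory Defs
  imports
    "HOL-Computational_Algebra.Polynomial"
    "Jordan_Normal_Form.VS_Connect"
begin

definition is_subalgebra :: "'a::field poly set \<Rightarrow> bool" where
  "is_subalgebra A \<longleftrightarrow>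
     (\<forall>c. [:c:] \<in> A) \<and>
     (\<forall>f\<in>A. \<forall>g\<in>A. f + g \<in> A) \<and>
     (\<forall>c. \<forall>f\<in>A. Polynomial.smult c f \<in> A) \<and>
     (\<forall>f\<in>A. \<forall>g\<in>A. f * g \<in> A)"

text \<open>
  The quotient vector space \<open>K[x] / A\<close> for a linear subspace \<open>A\<close>: its vectors are the cosets
  \<open>f + A\<close>. Since \<open>0 \<cdot> (f + A)\<close> must be the coset \<open>A\<close> rather than \<open>{0}\<close>, the scalar multiple
  \<open>c \<cdot> X\<close> is saturated by adding \<open>A\<close>. A \<open>module\<close> record extends a ring record, but modules
  and vector spaces do not use its fields \<open>mult\<close> and \<open>one\<close>.
\<close>

definition quotient_space :: "'a::field poly set \<Rightarrow> ('a, 'a poly set) module" where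
  "quotient_space A =
     \<lparr> carrier = range (\<lambda>f. {f + a | a. a \<in> A}),
       mult = undefined,
       one = undefined,
       zero = A,
       add = (\<lambda>X Y. {f + g | f g. f \<in> X \<and> g \<in> Y}),
       smult = (\<lambda>c X. {Polynomial.smult c f + a | f a. f \<in> X \<and> a \<in> A}) \<rparr>"

text \<open>
  Finite-dimensionality is required separately because \<open>vectorspace.dim\<close> is unspecified
  for infinite-dimensional spaces.
\<close>

definition has_codimension :: "'a::field poly set \<Rightarrow> nat \<Rightarrow> bool" where
  "has_codimension A n \<longleftrightarrow>
     vectorspace.fin_dim class_ring (quotient_space A) \<and>
     vectorspace.dim class_ring (quotient_space A) = n"

text \<open>
  The constants \<open>vectorspace.fin_dim\<close> and \<open>vectorspace.dim\<close> are only meaningful for vector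
  spaces, which \<open>quotient_space A\<close> is.
\<close>

lemma quotient_space_add:
  assumes "is_subalgebra A"
  shows "{h + k | h k. h \<in> {f + a | a. a \<in> A} \<and> k \<in> {g + a | a. a \<in> A}} =
         {(f + g) + a | a. a \<in> A}"
proof -
  have "[:0:] \<in> A" and add: "\<And>a b. a \<in> A \<Longrightarrow> b \<in> A \<Longrightarrow> a + b \<in> A"
    using assms unfolding is_subalgebra_def by blast+
  then have zero: "0 \<in> A"
    by simp
  show ?thesis
  proof (rule subset_antisym; rule subsetI)
    fix x assume "x \<in> {h + k | h k. h \<in> {f + a | a. a \<in> A} \<and> k \<in> {g + a | a. a \<in> A}}"
    then obtain a b where "a \<in> A" "b \<in> A" "x = (f + a) + (g + b)"
      by blast
    then have "x = (f + g) + (a + b)" "a + b \<in> A"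
      using add by simp_all
    then show "x \<in> {(f + g) + a | a. a \<in> A}"
      by blast
  next
    fix x assume "x \<in> {(f + g) + a | a. a \<in> A}"
    then obtain a where a: "a \<in> A" "x = (f + g) + a"
      by blast
    then have "x = (f + a) + (g + 0)"
      by simp
    with a(1) zero
    show "x \<in> {h + k | h k. h \<in> {f + a | a. a \<in> A} \<and> k \<in> {g + a | a. a \<in> A}}"
      by blast
  qed
qed

lemma quotient_space_smult:
  assumes "is_subalgebra A"
  shows "{Polynomial.smult c h + b | h b. h \<in> {f + a | a. a \<in> A} \<and> b \<in> A} =
         {Polynomial.smult c f + a | a. a \<in> A}"
proof -
  have "[:0:] \<in> A" and add: "\<And>a b. a \<in> A \<Longrightarrow> b \<in> A \<Longrightarrow> a + b \<in> A"
    and smult: "\<And>c a. a \<in> A \<Longrightarrow> Polynomial.smult c a \<in> A"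
    using assms unfolding is_subalgebra_def by blast+
  then have zero: "0 \<in> A"
    by simp
  show ?thesis
  proof (rule subset_antisym; rule subsetI)
    fix x assume "x \<in> {Polynomial.smult c h + b | h b. h \<in> {f + a | a. a \<in> A} \<and> b \<in> A}"
    then obtain a b where "a \<in> A" "b \<in> A" "x = Polynomial.smult c (f + a) + b"
      by blast
    then have "x = Polynomial.smult c f + (Polynomial.smult c a + b)"
      "Polynomial.smult c a + b \<in> A"
      using add smult by (simp_all add: smult_add_right)
    then show "x \<in> {Polynomial.smult c f + a | a. a \<in> A}"
      by blast
  next
    fix x assume "x \<in> {Polynomial.smult c f + a | a. a \<in> A}"
    then obtain a where a: "a \<in> A" "x = Polynomial.smult c (f + 0) + a"
      by auto
    with zero show "x \<in> {Polynomial.smult c h + b | h b. h \<in> {f + a | a. a \<in> A} \<and> b \<in> A}"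
      by blast
  qed
qed

lemma vectorspace_quotient_space:
  fixes A :: "'a::field poly set"
  assumes "is_subalgebra A"
  shows "vectorspace class_ring (quotient_space A)"
proof -
  let ?V = "quotient_space A"
  let ?q = "\<lambda>f. {f + a | a. a \<in> A}"
  have carrier: "carrier ?V = range ?q"
    by (simp add: quotient_space_def)
  have zero: "\<zero>\<^bsub>?V\<^esub> = ?q 0"
    by (simp add: quotient_space_def)
  have add: "?q f \<oplus>\<^bsub>?V\<^esub> ?q g = ?q (f + g)" for f g
    using quotient_space_add[OF assms, of f g] by (simp add: quotient_space_def)
  have smult: "c \<odot>\<^bsub>?V\<^esub> ?q f = ?q (Polynomial.smult c f)" for c f
    using quotient_space_smult[OF assms, of c f] by (simp add: quotient_space_def)
  have group: "abelian_group ?V"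
  proof (rule abelian_groupI)
    fix X Y Z
    assume "X \<in> carrier ?V" "Y \<in> carrier ?V" "Z \<in> carrier ?V"
    then obtain f g h where X: "X = ?q f" and Y: "Y = ?q g" and Z: "Z = ?q h"
      unfolding carrier by blast
    show "X \<oplus>\<^bsub>?V\<^esub> Y \<in> carrier ?V"
      unfolding X Y add carrier by (rule rangeI)
    show "X \<oplus>\<^bsub>?V\<^esub> Y \<oplus>\<^bsub>?V\<^esub> Z = X \<oplus>\<^bsub>?V\<^esub> (Y \<oplus>\<^bsub>?V\<^esub> Z)"
      unfolding X Y Z add by (simp only: add.assoc)
    show "X \<oplus>\<^bsub>?V\<^esub> Y = Y \<oplus>\<^bsub>?V\<^esub> X"
      unfolding X Y add by (simp only: add.commute)
  next
    show "\<zero>\<^bsub>?V\<^esub> \<in> carrier ?V"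
      unfolding zero carrier by (rule rangeI)
  next
    fix X
    assume "X \<in> carrier ?V"
    then obtain f where X: "X = ?q f"
      unfolding carrier by blast
    show "\<zero>\<^bsub>?V\<^esub> \<oplus>\<^bsub>?V\<^esub> X = X"
      unfolding X zero add by simp
    have "?q (- f) \<oplus>\<^bsub>?V\<^esub> X = \<zero>\<^bsub>?V\<^esub>"
      unfolding X zero add by simp
    then show "\<exists>Y\<in>carrier ?V. Y \<oplus>\<^bsub>?V\<^esub> X = \<zero>\<^bsub>?V\<^esub>"
      unfolding carrier by blast
  qed
  have "Module.module class_ring ?V"
  proof (rule moduleI)
    show "cring (class_ring :: 'a ring)"
      by (rule class_cring.cring_axioms)
    show "abelian_group ?V"
      by (rule group)
  next
    fix c d :: 'a and X Y
    assume "X \<in> carrier ?V" "Y \<in> carrier ?V"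
    then obtain f g where X: "X = ?q f" and Y: "Y = ?q g"
      unfolding carrier by blast
    show "c \<odot>\<^bsub>?V\<^esub> X \<in> carrier ?V"
      unfolding X smult carrier by (rule rangeI)
    show "(c \<oplus>\<^bsub>class_ring\<^esub> d) \<odot>\<^bsub>?V\<^esub> X = c \<odot>\<^bsub>?V\<^esub> X \<oplus>\<^bsub>?V\<^esub> d \<odot>\<^bsub>?V\<^esub> X"
      unfolding X smult add by (simp add: smult_add_left)
    show "c \<odot>\<^bsub>?V\<^esub> (X \<oplus>\<^bsub>?V\<^esub> Y) = c \<odot>\<^bsub>?V\<^esub> X \<oplus>\<^bsub>?V\<^esub> c \<odot>\<^bsub>?V\<^esub> Y"
      unfolding X Y smult add by (simp add: smult_add_right)
    show "(c \<otimes>\<^bsub>class_ring\<^esub> d) \<odot>\<^bsub>?V\<^esub> X = c \<odot>\<^bsub>?V\<^esub> (d \<odot>\<^bsub>?V\<^esub> X)"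
      unfolding X smult by simp
    show "\<one>\<^bsub>class_ring\<^esub> \<odot>\<^bsub>?V\<^esub> X = X"
      unfolding X smult by simp
  qed
  then show ?thesis
    by (intro vectorspace.intro class_field.field_axioms)
qed

end

theory Submission
  imports Defs
begin

text \<open>
  Codimension one gives a polynomial \<open>g \<notin> A\<close> with \<open>K[x] = A + K g\<close>. The subalgebra generated
  by \<open>x\<close> and the constants is all of \<open>K[x]\<close>, so \<open>x \<notin> A\<close>, and then \<open>x\<close> itself can play the role
  of \<open>g\<close>: \<open>K[x] = A + K x\<close> (\<open>codimension_one_complement_X\<close>).

  The key point is that \<open>A\<close> contains a nonzero ideal of \<open>K[x]\<close>, generated by a quadratic \<open>q\<close>.
  Multiplication by an element of \<open>A\<close> acts on the line \<open>K[x] / A\<close> by a scalar. Choose \<open>s\<close> with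
  \<open>x\<^sup>2 - s x \<in> A\<close>, and subtract from this element the scalar by which it acts; the resulting
  \<open>q = x\<^sup>2 - s x - t \<in> A\<close> kills \<open>K[x] / A\<close>, that is, \<open>q K[x] \<subseteq> A\<close>
  (\<open>codimension_one_quadratic_ideal\<close>).

  Division by \<open>q\<close> now decides membership: since the constants lie in \<open>A\<close> and \<open>x\<close> does not, \<open>f\<close>
  belongs to \<open>A\<close> exactly when its remainder modulo \<open>q\<close> is constant. Over an algebraically closed
  field \<open>q = (x - \<alpha>) (x - \<beta>)\<close>. If \<open>\<alpha> \<noteq> \<beta>\<close>, the remainder interpolates \<open>f\<close> at \<open>\<alpha>\<close> and \<open>\<beta>\<close>, and is
  constant iff \<open>f(\<alpha>) = f(\<beta>)\<close>; if \<open>\<alpha> = \<beta>\<close>, it is the tangent line of \<open>f\<close> at \<open>\<alpha>\<close>, and is constant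
  iff \<open>f'(\<alpha>) = 0\<close>.
\<close>

lemma is_subalgebraD:
  assumes "is_subalgebra A"
  shows is_subalgebra_const: "[:c:] \<in> A"
    and is_subalgebra_add: "f \<in> A \<Longrightarrow> g \<in> A \<Longrightarrow> f + g \<in> A"
    and is_subalgebra_smult: "f \<in> A \<Longrightarrow> Polynomial.smult c f \<in> A"
    and is_subalgebra_mult: "f \<in> A \<Longrightarrow> g \<in> A \<Longrightarrow> f * g \<in> A"
  using assms unfolding is_subalgebra_def by blast+

lemma is_subalgebra_diff:
  assumes "is_subalgebra A" "f \<in> A" "g \<in> A"
  shows "f - g \<in> A"
  using is_subalgebra_add[OF assms(1,2) is_subalgebra_smult[OF assms(1,3), of "-1"]] by simp

text \<open>
  The passage from the dimension of the space of cosets to polynomials: \<open>g\<close> represents the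
  single vector of a basis of \<open>K[x] / A\<close>.
\<close>

lemma codimension_one_complement:
  assumes A: "is_subalgebra A" and codim: "has_codimension A 1"
  obtains g where "g \<notin> A" "\<And>f. \<exists>c. f - Polynomial.smult c g \<in> A"
proof -
  let ?V = "quotient_space A"
  let ?q = "\<lambda>f. {f + a | a. a \<in> A}"
  interpret V: vectorspace class_ring ?V
    by (rule vectorspace_quotient_space[OF A])
  have zero_mem: "0 \<in> A"
    using is_subalgebra_const[OF A, of 0] by simp
  have "V.fin_dim" "V.dim = 1"
    using codim unfolding has_codimension_def by auto
  then obtain B where "finite B" "V.basis B" "card B = 1"
    using V.finite_basis_exists V.dim_basis by metis
  then obtain v where "V.basis {v}"
    by (metis card_1_singletonE)
  then have indpt: "\<not> V.lin_dep {v}" and gen: "V.span {v} = carrier ?V" and v: "v \<in> carrier ?V"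
    unfolding V.basis_def by auto
  obtain g where g: "v = ?q g"
    using v unfolding quotient_space_def by auto
  have "g \<notin> A"
  proof
    assume gA: "g \<in> A"
    have "v = A"
    proof (rule subset_antisym; rule subsetI)
      fix f assume "f \<in> v"
      then show "f \<in> A"
        using is_subalgebra_add[OF A gA] unfolding g by blast
    next
      fix f assume "f \<in> A"
      then have "f = g + (f - g)" "f - g \<in> A"
        using is_subalgebra_diff[OF A _ gA] by auto
      then show "f \<in> v"
        unfolding g by blast
    qed
    then have "v = \<zero>\<^bsub>?V\<^esub>"
      by (simp add: quotient_space_def)
    moreover have "\<zero>\<^bsub>?V\<^esub> \<notin> {v}"
      using V.vs_zero_lin_dep[of "{v}"] v indpt by blast
    ultimately show False
      by simp
  qed
  moreover have "\<exists>c. f - Polynomial.smult c g \<in> A" for f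
  proof -
    have "?q f \<in> V.span {v}"
      unfolding gen by (auto simp: quotient_space_def)
    then obtain a where "?q f = V.lincomb a {v}"
      using V.finite_span[of "{v}"] v by auto
    then have "?q f = a v \<odot>\<^bsub>?V\<^esub> v"
      using v by (simp add: V.lincomb_def)
    also have "\<dots> = ?q (Polynomial.smult (a v) g)"
      using quotient_space_smult[OF A, of "a v" g] by (simp add: quotient_space_def g)
    finally have "?q f = ?q (Polynomial.smult (a v) g)" .
    moreover have "f \<in> ?q f"
      using zero_mem by force
    ultimately have "f \<in> ?q (Polynomial.smult (a v) g)"
      by simp
    then obtain b where "b \<in> A" "f = Polynomial.smult (a v) g + b"
      by blast
    then show ?thesis
      by (intro exI[of _ "a v"]) simp
  qed
  ultimately show thesis
    using that by blast
qed

lemma is_subalgebra_eq_UNIV_if_X: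
  assumes A: "is_subalgebra A" and X: "[:0, 1:] \<in> A"
  shows "f \<in> A"
proof (induction f)
  case 0
  then show ?case
    using is_subalgebra_const[OF A, of 0] by simp
next
  case (pCons a f)
  have "pCons a f = [:a:] + [:0, 1:] * f"
    by simp
  then show ?case
    using is_subalgebra_add[OF A is_subalgebra_const[OF A] is_subalgebra_mult[OF A X pCons.IH]]
    by metis
qed

lemma codimension_one_complement_X:
  assumes A: "is_subalgebra A" and codim: "has_codimension A 1"
  shows "[:0, 1:] \<notin> A" "\<exists>c. f - [:0, c:] \<in> A"
proof -
  obtain g where g: "g \<notin> A" and compl: "\<And>f. \<exists>c. f - Polynomial.smult c g \<in> A"
    using codimension_one_complement[OF A codim] by blast
  show X: "[:0, 1:] \<notin> A"
    using is_subalgebra_eq_UNIV_if_X[OF A] g by blast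
  obtain d where d: "[:0, 1:] - Polynomial.smult d g \<in> A"
    using compl by blast
  then have "d \<noteq> 0"
    using X by auto
  obtain c where c: "f - Polynomial.smult c g \<in> A"
    using compl by blast
  have "f - [:0, c / d:] =
      (f - Polynomial.smult c g) - Polynomial.smult (c / d) ([:0, 1:] - Polynomial.smult d g)"
    using \<open>d \<noteq> 0\<close> by (simp add: smult_diff_right)
  also have "\<dots> \<in> A"
    by (intro is_subalgebra_diff[OF A] is_subalgebra_smult[OF A] c d)
  finally show "\<exists>c. f - [:0, c:] \<in> A"
    by blast
qed

text \<open>
  Because \<open>q \<in> A\<close>, multiplication by \<open>q\<close> maps \<open>A\<close> into itself, so on \<open>K[x] = A + K x\<close> it remains
  to arrange \<open>q x \<in> A\<close>; the free constant term of \<open>q\<close> serves this purpose.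
\<close>

lemma codimension_one_quadratic_ideal:
  assumes A: "is_subalgebra A" and codim: "has_codimension A 1"
  obtains s t where "\<And>f. [:t, s, 1:] * f \<in> A"
proof -
  note compl = codimension_one_complement_X(2)[OF A codim]
  obtain s where s: "[:0, 0, 1:] - [:0, s:] \<in> A"
    using compl by blast
  obtain t where t: "[:0, -s, 1:] * [:0, 1:] - [:0, t:] \<in> A"
    using compl by blast
  let ?q = "[:-t, -s, 1:]"
  have "?q = ([:0, 0, 1:] - [:0, s:]) + [:-t:]"
    by simp
  then have q: "?q \<in> A"
    using is_subalgebra_add[OF A s is_subalgebra_const[OF A]] by metis
  have qX: "?q * [:0, 1:] \<in> A"
    using t by simp
  have "?q * f \<in> A" for f
  proof -
    obtain c where c: "f - [:0, c:] \<in> A"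
      using compl by blast
    have "?q * f = ?q * (f - [:0, c:]) + ?q * [:0, c:]"
      by (simp only: right_diff_distrib diff_add_cancel)
    also have "?q * [:0, c:] = Polynomial.smult c (?q * [:0, 1:])"
      by simp
    also have "?q * (f - [:0, c:]) + \<dots> \<in> A"
      by (intro is_subalgebra_add[OF A] is_subalgebra_mult[OF A] is_subalgebra_smult[OF A] q c qX)
    finally show ?thesis .
  qed
  then show thesis
    using that by blast
qed

lemma monic_quadratic_splits:
  fixes s t :: "'a::alg_closed_field"
  obtains \<alpha> \<beta> where "[:t, s, 1:] = [:-\<alpha>, 1:] * [:-\<beta>, 1:]"
proof -
  obtain \<alpha> where "poly [:t, s, 1:] \<alpha> = 0"
    using alg_closed_imp_poly_has_root[of "[:t, s, 1:]"] by auto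
  then have "t = - (\<alpha> * (s + \<alpha>))"
    by (simp add: eq_neg_iff_add_eq_0)
  \<comment> \<open>The roots sum to \<open>-s\<close>, so the second one is \<open>-s - \<alpha>\<close>.\<close>
  then have "[:t, s, 1:] = [:-\<alpha>, 1:] * [:-(-s - \<alpha>), 1:]"
    by (simp add: algebra_simps)
  then show thesis
    by (rule that)
qed

lemma poly_quadratic_remainder:
  fixes s t :: "'a::field"
  obtains h r\<^sub>0 r\<^sub>1 where "f = [:t, s, 1:] * h + [:r\<^sub>0, r\<^sub>1:]"
proof -
  let ?q = "[:t, s, 1:]" and ?r = "f mod [:t, s, 1:]"
  have "?r = 0 \<or> degree ?r < degree ?q"
    by (rule degree_mod_less) simp
  then have "degree ?r \<le> 1"
    by auto
  moreover obtain r\<^sub>0 p where r: "?r = pCons r\<^sub>0 p"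
    by (cases ?r)
  ultimately have "degree p = 0"
    by (auto simp: degree_pCons_eq_if split: if_splits)
  then obtain r\<^sub>1 where "?r = [:r\<^sub>0, r\<^sub>1:]"
    unfolding r by (auto elim: degree_eq_zeroE)
  then have "f = ?q * (f div ?q) + [:r\<^sub>0, r\<^sub>1:]"
    by (metis mult_div_mod_eq)
  then show thesis
    by (rule that)
qed

theorem theorem3:
  fixes A :: "'a::{alg_closed_field, field_char_0} poly set"
  assumes "is_subalgebra A"
    and "has_codimension A 1"
  shows "(\<exists>\<gamma>. \<forall>f. f \<in> A \<longleftrightarrow> poly (pderiv f) \<gamma> = 0) \<or>
         (\<exists>\<alpha> \<beta>. \<alpha> \<noteq> \<beta> \<and> (\<forall>f. f \<in> A \<longleftrightarrow> poly f \<alpha> = poly f \<beta>))"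
proof -
  note A = assms(1)
  note X = codimension_one_complement_X(1)[OF assms]
  obtain s t where ideal: "\<And>f. [:t, s, 1:] * f \<in> A"
    using codimension_one_quadratic_ideal[OF assms] by blast
  obtain \<alpha> \<beta> where q: "[:t, s, 1:] = [:-\<alpha>, 1:] * [:-\<beta>, 1:]"
    using monic_quadratic_splits by blast
  have mem_iff: "[:t, s, 1:] * h + [:r\<^sub>0, r\<^sub>1:] \<in> A \<longleftrightarrow> r\<^sub>1 = 0" for h r\<^sub>0 r\<^sub>1
  proof
    assume mem: "[:t, s, 1:] * h + [:r\<^sub>0, r\<^sub>1:] \<in> A"
    have "[:0, r\<^sub>1:] = ([:t, s, 1:] * h + [:r\<^sub>0, r\<^sub>1:]) - [:t, s, 1:] * h - [:r\<^sub>0:]"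
      by simp
    also have "\<dots> \<in> A"
      by (intro is_subalgebra_diff[OF A] mem ideal is_subalgebra_const[OF A])
    finally have "Polynomial.smult (inverse r\<^sub>1) [:0, r\<^sub>1:] \<in> A"
      by (rule is_subalgebra_smult[OF A])
    then show "r\<^sub>1 = 0"
      using X by (cases "r\<^sub>1 = 0") auto
  next
    assume "r\<^sub>1 = 0"
    then show "[:t, s, 1:] * h + [:r\<^sub>0, r\<^sub>1:] \<in> A"
      using is_subalgebra_add[OF A ideal is_subalgebra_const[OF A]] by simp
  qed
  show ?thesis
  proof (cases "\<alpha> = \<beta>")
    case True
    have "f \<in> A \<longleftrightarrow> poly (pderiv f) \<alpha> = 0" for f
    proof -
      obtain h r\<^sub>0 r\<^sub>1 where f: "f = [:t, s, 1:] * h + [:r\<^sub>0, r\<^sub>1:]"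
        by (rule poly_quadratic_remainder)
      have "poly (pderiv f) \<alpha> = r\<^sub>1"
        unfolding f q True
        by (simp add: pderiv_add pderiv_mult pderiv_pCons del: mult_pCons_left mult_pCons_right)
      then show ?thesis
        using mem_iff f by simp
    qed
    then show ?thesis
      by blast
  next
    case False
    have "f \<in> A \<longleftrightarrow> poly f \<alpha> = poly f \<beta>" for f
    proof -
      obtain h r\<^sub>0 r\<^sub>1 where f: "f = [:t, s, 1:] * h + [:r\<^sub>0, r\<^sub>1:]"
        by (rule poly_quadratic_remainder)
      have "poly f \<alpha> = r\<^sub>0 + \<alpha> * r\<^sub>1" "poly f \<beta> = r\<^sub>0 + \<beta> * r\<^sub>1"
        unfolding f q by (simp_all del: mult_pCons_left mult_pCons_right)
      then show ?thesis
        using mem_iff f False by simp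
    qed
    then show ?thesis
      using False by blast
  qed
qed

end
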